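(* In the problem of scheduling with uncertain processing times on a single machine (objective: total completion time), for every online algorithm $A$ that generates preemptive schedules there is an online algorithm $B$ that generates non-preemptive schedules and performs as well as $A$ in terms of competitive ratio, i.e. the competitive ratio of $B$ is at most that of $A$.
   Context: Problem. There are $n$ jobs, all available at time $0$. Job $j$ has a testing time $t_j\ge 0$, an upper limit $u_j\ge 0$, and a real processing time $p_j\in[0,u_j]$. A job may be executed untested, which takes $u_j$ time units, or it may be tested (taking $t_j$ time units) and later executed in $p_j$ time units; other tasks may run between the test and the execution. The tasks regarding $j$ are its testing, its execution (after testing), or its execution-untested. A single machine runs at most one task at a time. The completion time of a job is the time at which its execution (or execution-untested) ends, and the cost of a schedule is the sum of the completion times of all jobs. A (deterministic) online algorithm knows all $t_j,u_j$ from the start, but learns $p_j$ only when the test of $j$ is finished. $\mathrm{OPT}$ knows all $p_j$ in advance (but must still test $j$ in order to run it in time $p_j$), and its cost is the minimum cost of any schedule. The competitive ratio of an online algorithm $A$ is the smallest $c$ such that $\mathrm{cost}(A)\le c\cdot \mathrm{cost}(\mathrm{OPT})$ on all instances. A schedule is preemptive if tasks may be interrupted and resumed later, so that a task may be divided into several non-contiguous parts; it is non-preemptive if every task is run in one contiguous time interval (the testing and the execution of the same job need not be adjacent). *)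

theory Defs
  imports "HOL-Library.Extended_Real"
begin

record job =
  test_time :: real
  upper_limit :: real
  proc_time :: real

type_synonym inst = "job list"

definition valid_inst :: "inst \<Rightarrow> bool" where
  "valid_inst I \<longleftrightarrow>
     (\<forall>J \<in> set I. 0 \<le> test_time J \<and> 0 \<le> upper_limit J \<and>
                  0 \<le> proc_time J \<and> proc_time J \<le> upper_limit J)"

definition public_data :: "inst \<Rightarrow> (real \<times> real) list" where
  "public_data I = map (\<lambda>J. (test_time J, upper_limit J)) I"

text \<open>\<open>Exec j\<close> is the execution of job \<open>j\<close> after its test, \<open>Untested j\<close> its execution-untested.\<close>

datatype task = Test (job_of: nat) | Exec (job_of: nat) | Untested (job_of: nat)

fun duration :: "inst \<Rightarrow> task \<Rightarrow> real" where
  "duration I (Test j) = test_time (I ! j)"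
| "duration I (Exec j) = proc_time (I ! j)"
| "duration I (Untested j) = upper_limit (I ! j)"

text \<open>A schedule is the chronological list of the pieces run by the machine. The list order is
  significant when durations are zero: it tells in which order tasks that take place at
  the same point in time are performed. Gaps between consecutive pieces are idle time.\<close>

datatype piece = Piece (task_of: task) (start_of: real) (end_of: real)

type_synonym sched = "piece list"

definition tasks :: "sched \<Rightarrow> task set" where
  "tasks S = task_of ` set S"

definition work :: "sched \<Rightarrow> task \<Rightarrow> real" where
  "work S x = (\<Sum>a \<leftarrow> filter (\<lambda>a. task_of a = x) S. end_of a - start_of a)"

text \<open>The condition \<open>x \<in> tasks S\<close> matters for tasks of duration zero: these also have to be performed.\<close>

definition finished :: "inst \<Rightarrow> sched \<Rightarrow> task \<Rightarrow> bool" where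
  "finished I S x \<longleftrightarrow> x \<in> tasks S \<and> work S x = duration I x"

text \<open>Feasible schedules, with preemption allowed: a task may be spread over several pieces.\<close>

definition feasible :: "inst \<Rightarrow> sched \<Rightarrow> bool" where
  "feasible I S \<longleftrightarrow>
     (\<forall>a \<in> set S. job_of (task_of a) < length I \<and> 0 \<le> start_of a \<and> start_of a \<le> end_of a) \<and>
     sorted_wrt (\<lambda>a b. end_of a \<le> start_of b) S \<and>
     (\<forall>j < length I.
        (Untested j \<in> tasks S \<and> Test j \<notin> tasks S \<and> Exec j \<notin> tasks S) \<or>
        (Untested j \<notin> tasks S \<and> Test j \<in> tasks S \<and> Exec j \<in> tasks S)) \<and>
     (\<forall>x \<in> tasks S. finished I S x) \<and>
     (\<forall>i < length S. \<not> finished I (take i S) (task_of (S ! i))) \<and>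
     (\<forall>i < length S. \<forall>j. task_of (S ! i) = Exec j \<longrightarrow> finished I (take i S) (Test j))"

definition nonpreemptive :: "sched \<Rightarrow> bool" where
  "nonpreemptive S \<longleftrightarrow> distinct (map task_of S)"

definition completion :: "sched \<Rightarrow> nat \<Rightarrow> real" where
  "completion S j = Max (end_of ` {a \<in> set S. task_of a = Exec j \<or> task_of a = Untested j})"

definition cost :: "inst \<Rightarrow> sched \<Rightarrow> real" where
  "cost I S = (\<Sum>j < length I. completion S j)"

definition opt :: "inst \<Rightarrow> real" where
  "opt I = Inf {cost I S | S. feasible I S}"

text \<open>A deterministic online algorithm is a map from instances to schedules in which every decision
  (run a further piece, and which one, or stop) depends only on the public data, the pieces
  run so far, and the processing times of the jobs whose tests these pieces have finished.
  Deciding piece by piece is no restriction, because processing times are revealed only at ends of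
  pieces.\<close>

definition online_algorithm :: "(inst \<Rightarrow> sched) \<Rightarrow> bool" where
  "online_algorithm A \<longleftrightarrow>
     (\<forall>I. valid_inst I \<longrightarrow> feasible I (A I)) \<and>
     (\<forall>I I' k. valid_inst I \<and> valid_inst I' \<and> public_data I = public_data I' \<and>
        take k (A I) = take k (A I') \<and>
        (\<forall>j < length I. finished I (take k (A I)) (Test j) \<longrightarrow>
            proc_time (I ! j) = proc_time (I' ! j))
        \<longrightarrow> take (Suc k) (A I) = take (Suc k) (A I'))"

text \<open>The value is \<open>\<infinity>\<close> if no real \<open>c\<close> bounds the ratio.\<close>

definition competitive_ratio :: "(inst \<Rightarrow> sched) \<Rightarrow> ereal" where
  "competitive_ratio A =
     Inf {ereal c | c. \<forall>I. valid_inst I \<longrightarrow> cost I (A I) \<le> c * opt I}"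

end

theory Submission
  imports Defs
begin

text \<open>The algorithm \<open>B\<close> simulates \<open>A\<close>. Whenever a task is completed in \<open>A\<close>'s schedule, \<open>B\<close> runs this
  whole task in one piece. So \<open>B\<close> runs the tasks in \<open>A\<close>'s order of completion and without idle time,
  and a task that ends at time \<open>C\<close> in \<open>A\<close>'s schedule ends no later in \<open>B\<close>'s, because all the work that
  \<open>B\<close> has done until then is done by \<open>A\<close> before \<open>C\<close>. The processing times on which the simulated
  decisions of \<open>A\<close> depend belong to jobs whose tests have ended in \<open>A\<close>'s schedule, hence also in \<open>B\<close>'s.\<close>

definition completion_order :: "inst \<Rightarrow> sched \<Rightarrow> task list" where
  "completion_order I S =
     map (\<lambda>i. task_of (S ! i))
       (filter (\<lambda>i. finished I (take (Suc i) S) (task_of (S ! i))) [0..<length S])"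

fun run_from :: "inst \<Rightarrow> real \<Rightarrow> task list \<Rightarrow> sched" where
  "run_from I t [] = []"
| "run_from I t (x # xs) = Piece x t (t + duration I x) # run_from I (t + duration I x) xs"

definition nonpreempt :: "(inst \<Rightarrow> sched) \<Rightarrow> inst \<Rightarrow> sched" where
  "nonpreempt A I = run_from I 0 (completion_order I (A I))"


subsection \<open>The order of completion\<close>

lemma completion_order_Nil [simp]: "completion_order I [] = []"
  by (simp add: completion_order_def)

lemma completion_order_snoc:
  "completion_order I (S @ [a]) =
     completion_order I S @ (if finished I (S @ [a]) (task_of a) then [task_of a] else [])"
proof -
  have "filter (\<lambda>i. finished I (take (Suc i) (S @ [a])) (task_of ((S @ [a]) ! i))) [0..<length S]
      = filter (\<lambda>i. finished I (take (Suc i) S) (task_of (S ! i))) [0..<length S]"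
    by (rule filter_cong) (auto simp: nth_append)
  then show ?thesis
    by (auto simp: completion_order_def nth_append)
qed

text \<open>Whether an index is kept depends only on the schedule up to and including its piece, so
  later pieces can only append tasks. This monotonicity in prefixes lets the simulation proceed
  online.\<close>

lemma completion_order_append: "\<exists>ys. completion_order I (S @ T) = completion_order I S @ ys"
proof (induction T rule: rev_induct)
  case (snoc a T)
  then show ?case
    using completion_order_snoc[of I "S @ T" a] by auto
qed simp

lemma completion_order_take: "\<exists>ys. completion_order I S = completion_order I (take m S) @ ys"
  by (metis append_take_drop_id completion_order_append)

lemma finished_snoc_other:
  "x \<noteq> task_of a \<Longrightarrow> finished I (S @ [a]) x \<longleftrightarrow> finished I S x"
  by (auto simp: finished_def tasks_def work_def)

text \<open>A clause of \<open>feasible\<close>, isolated because it passes to prefixes, which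
  feasibility as a whole does not; \<open>tests_first\<close> below serves the same purpose.\<close>

definition no_rerun :: "inst \<Rightarrow> sched \<Rightarrow> bool" where
  "no_rerun I S \<longleftrightarrow> (\<forall>i < length S. \<not> finished I (take i S) (task_of (S ! i)))"

lemma no_rerun_snoc:
  "no_rerun I (S @ [a]) \<longleftrightarrow> no_rerun I S \<and> \<not> finished I S (task_of a)"
  by (auto simp: no_rerun_def nth_append less_Suc_eq)

lemma no_rerun_take: "no_rerun I S \<Longrightarrow> no_rerun I (take m S)"
  by (auto simp: no_rerun_def min_def)

text \<open>\<open>finished\<close> demands that work equals duration, so a further piece of the
  same task could undo it. \<open>no_rerun\<close> forbids such a piece: a recorded task stays
  finished.\<close>

lemma set_completion_order:
  "no_rerun I S \<Longrightarrow> set (completion_order I S) = {x. finished I S x}"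
proof (induction S rule: rev_induct)
  case Nil
  then show ?case by (simp add: finished_def tasks_def)
next
  case (snoc a S)
  then have "set (completion_order I S) = {x. finished I S x}" "\<not> finished I S (task_of a)"
    by (auto simp: no_rerun_snoc)
  then show ?case
    using finished_snoc_other[of _ a I S] by (auto simp: completion_order_snoc) metis+
qed

lemma distinct_completion_order: "no_rerun I S \<Longrightarrow> distinct (completion_order I S)"
  by (induction S rule: rev_induct)
     (auto simp: completion_order_snoc no_rerun_snoc set_completion_order)

definition tests_first :: "inst \<Rightarrow> sched \<Rightarrow> bool" where
  "tests_first I S \<longleftrightarrow>
     (\<forall>i < length S. \<forall>j. task_of (S ! i) = Exec j \<longrightarrow> finished I (take i S) (Test j))"

lemma tests_first_snoc:
  "tests_first I (S @ [a]) \<longleftrightarrow>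
     tests_first I S \<and> (\<forall>j. task_of a = Exec j \<longrightarrow> finished I S (Test j))"
  by (auto simp: tests_first_def nth_append less_Suc_eq)

text \<open>When a piece of \<open>Exec j\<close> runs, the test of \<open>j\<close> is finished and
  therefore already recorded. The argument uses list positions rather than times, so it covers tasks
  of duration zero.\<close>

lemma completion_order_tests_first:
  assumes "no_rerun I S" "tests_first I S"
    and "i < length (completion_order I S)" "completion_order I S ! i = Exec j"
  shows "Test j \<in> set (take i (completion_order I S))"
  using assms
proof (induction S arbitrary: i rule: rev_induct)
  case (snoc a S)
  then have S: "no_rerun I S" "tests_first I S"
    by (auto simp: no_rerun_snoc tests_first_snoc)
  show ?case
  proof (cases "i < length (completion_order I S)")
    case True
    then show ?thesis
      using snoc.IH[OF S True] snoc.prems by (auto simp: completion_order_snoc nth_append)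
  next
    case False
    then have "i = length (completion_order I S)" "task_of a = Exec j"
      using snoc.prems by (auto simp: completion_order_snoc nth_append split: if_splits)
    then show ?thesis
      using snoc.prems S by (auto simp: completion_order_snoc tests_first_snoc set_completion_order)
  qed
qed simp


subsection \<open>Running tasks back to back\<close>

lemma task_of_run_from [simp]: "map task_of (run_from I t xs) = xs"
  by (induction xs arbitrary: t) auto

lemma length_run_from [simp]: "length (run_from I t xs) = length xs"
  by (metis length_map task_of_run_from)

lemma task_of_nth_run_from: "i < length xs \<Longrightarrow> task_of (run_from I t xs ! i) = xs ! i"
  by (metis length_run_from nth_map task_of_run_from)

lemma tasks_run_from [simp]: "tasks (run_from I t xs) = set xs"
  by (metis set_map task_of_run_from tasks_def)

lemma take_run_from: "take k (run_from I t xs) = run_from I t (take k xs)"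
  by (induction xs arbitrary: t k) (auto simp: take_Cons split: nat.split)

lemma run_from_append:
  "run_from I t (xs @ ys) =
     run_from I t xs @ run_from I (t + sum_list (map (duration I) xs)) ys"
  by (induction xs arbitrary: t) (auto simp: add.assoc)

lemma run_from_cong:
  "(\<And>x. x \<in> set xs \<Longrightarrow> duration I x = duration I' x) \<Longrightarrow> run_from I t xs = run_from I' t xs"
  by (induction xs arbitrary: t) auto

lemma work_run_from:
  "distinct xs \<Longrightarrow> work (run_from I t xs) x = (if x \<in> set xs then duration I x else 0)"
proof (induction xs arbitrary: t)
  case (Cons y xs)
  then have "work (run_from I (t + duration I y) xs) x = (if x \<in> set xs then duration I x else 0)"
    by simp
  then show ?case
    using Cons.prems by (auto simp: work_def)
qed (simp add: work_def)

lemma finished_run_from: "distinct xs \<Longrightarrow> finished I (run_from I t xs) x \<longleftrightarrow> x \<in> set xs"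
  by (auto simp: finished_def work_run_from)

lemma run_from_times:
  assumes "\<And>x. x \<in> set xs \<Longrightarrow> 0 \<le> duration I x" "a \<in> set (run_from I t xs)"
  shows "t \<le> start_of a \<and> start_of a \<le> end_of a"
  using assms
proof (induction xs arbitrary: t)
  case (Cons x xs)
  have "0 \<le> duration I x" using Cons.prems by simp
  moreover have "t + duration I x \<le> start_of a \<and> start_of a \<le> end_of a"
    if "a \<in> set (run_from I (t + duration I x) xs)"
    using Cons.IH[OF _ that] Cons.prems(1) by simp
  ultimately show ?case
    using Cons.prems(2) by auto
qed simp

lemma sorted_run_from:
  assumes "\<And>x. x \<in> set xs \<Longrightarrow> 0 \<le> duration I x"
  shows "sorted_wrt (\<lambda>a b. end_of a \<le> start_of b) (run_from I t xs)"
  using assms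
proof (induction xs arbitrary: t)
  case (Cons x xs)
  then show ?case
    using run_from_times[of xs I _ "t + duration I x"] by simp
qed simp


subsection \<open>Completion times\<close>

text \<open>Each piece counts towards the work of one task only, and the pieces of tasks outside
  \<open>F\<close> have nonnegative length.\<close>

lemma sum_work_le_total:
  assumes "finite F" "\<And>a. a \<in> set S \<Longrightarrow> start_of a \<le> end_of a"
  shows "(\<Sum>x\<in>F. work S x) \<le> (\<Sum>a\<leftarrow>S. end_of a - start_of a)"
  using assms(2)
proof (induction S)
  case (Cons a S)
  have "work (a # S) x = (if x = task_of a then end_of a - start_of a else 0) + work S x" for x
    by (simp add: work_def)
  then have "(\<Sum>x\<in>F. work (a # S) x) =
      (if task_of a \<in> F then end_of a - start_of a else 0) + (\<Sum>x\<in>F. work S x)"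
    using assms(1) by (simp add: sum.distrib)
  with Cons show ?case
    by (smt (verit) list.set_intros list.simps(9) sum_list.Cons)
qed (simp add: work_def)

text \<open>The pieces are non-overlapping intervals within [0, t]. In the induction, all pieces
  before the last one fit between 0 and its start, hence \<open>t\<close> has to vary.\<close>

lemma total_le_time:
  assumes "sorted_wrt (\<lambda>a b. end_of a \<le> start_of b) S" "0 \<le> t"
    and "\<And>a. a \<in> set S \<Longrightarrow> 0 \<le> start_of a \<and> end_of a \<le> t"
  shows "(\<Sum>a\<leftarrow>S. end_of a - start_of a) \<le> t"
  using assms
proof (induction S arbitrary: t rule: rev_induct)
  case (snoc a S)
  have "(\<Sum>a\<leftarrow>S. end_of a - start_of a) \<le> start_of a"
    by (rule snoc.IH) (use snoc.prems in \<open>auto simp: sorted_wrt_append\<close>)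
  moreover have "end_of a \<le> t"
    using snoc.prems(3) by simp
  ultimately show ?case
    by simp
qed simp

lemma feasible_no_rerun: "feasible I S \<Longrightarrow> no_rerun I S"
  and feasible_tests_first: "feasible I S \<Longrightarrow> tests_first I S"
  by (simp_all add: feasible_def no_rerun_def tests_first_def)

lemma feasible_set_completion_order:
  assumes "feasible I S"
  shows "set (completion_order I S) = tasks S"
proof -
  have "\<forall>x \<in> tasks S. finished I S x"
    using assms by (simp add: feasible_def)
  then show ?thesis
    using set_completion_order[OF feasible_no_rerun[OF assms]] by (auto simp: finished_def)
qed

text \<open>The witness is the piece of \<open>S\<close> that finishes the task of \<open>a\<close>.
  The time \<open>end_of a\<close> is the total duration of the tasks finished by then, and
  \<open>S\<close> has done all this work before that piece ends.\<close>

lemma run_completion_order_end_le: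
  assumes "feasible I S" "a \<in> set (run_from I 0 (completion_order I S))"
  shows "\<exists>b \<in> set S. task_of b = task_of a \<and> end_of a \<le> end_of b"
proof -
  have pieces: "0 \<le> start_of b \<and> start_of b \<le> end_of b" if "b \<in> set S" for b
    using assms(1) that by (auto simp: feasible_def)
  have sorted: "sorted_wrt (\<lambda>a b. end_of a \<le> start_of b) S"
    using assms(1) by (simp add: feasible_def)
  show ?thesis
    \<comment> \<open>Only consequences of feasibility that survive passing to prefixes enter the
      induction.\<close>
    using assms(2) feasible_no_rerun[OF assms(1)] pieces sorted
  proof (induction S rule: rev_induct)
    case (snoc b S)
    show ?case
    proof (cases "a \<in> set (run_from I 0 (completion_order I S))")
      case True
      then show ?thesis
        using snoc.IH snoc.prems by (auto simp: no_rerun_snoc sorted_wrt_append)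
    next
      case False
      let ?xs = "completion_order I (S @ [b])"
      \<comment> \<open>The piece \<open>a\<close> is new, so \<open>b\<close> must have finished
        its task and \<open>a\<close> is the last piece of the run.\<close>
      have xs: "?xs = completion_order I S @ [task_of b]"
        and a: "a = Piece (task_of b) (sum_list (map (duration I) (completion_order I S)))
                      (sum_list (map (duration I) ?xs))"
        using False snoc.prems(1)
        by (auto simp: completion_order_snoc run_from_append split: if_splits)
      have "sum_list (map (duration I) ?xs) = (\<Sum>x\<in>set ?xs. duration I x)"
        using distinct_completion_order[OF snoc.prems(2)] by (simp add: sum_list_distinct_conv_sum_set)
      also have "\<dots> = (\<Sum>x\<in>set ?xs. work (S @ [b]) x)"
        using set_completion_order[OF snoc.prems(2)]
        by (intro sum.cong) (auto simp: finished_def)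
      also have "\<dots> \<le> (\<Sum>c\<leftarrow>S @ [b]. end_of c - start_of c)"
        using snoc.prems(3) by (intro sum_work_le_total) auto
      also have "\<dots> \<le> end_of b"
      proof (rule total_le_time[OF snoc.prems(4)])
        show "0 \<le> end_of b"
          using snoc.prems(3)[of b] by simp
        show "0 \<le> start_of c \<and> end_of c \<le> end_of b" if "c \<in> set (S @ [b])" for c
          using that snoc.prems(3)[of b] snoc.prems(3)[of c] snoc.prems(4)
          by (force simp: sorted_wrt_append)
      qed
      finally show ?thesis
        using a by auto
    qed
  qed simp
qed

lemma completion_run_completion_order_le:
  assumes "feasible I S" "j < length I"
  shows "completion (run_from I 0 (completion_order I S)) j \<le> completion S j"
proof -
  let ?R = "run_from I 0 (completion_order I S)"
  let ?E = "\<lambda>T. {a \<in> set T. task_of a = Exec j \<or> task_of a = Untested j}"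
  \<comment> \<open>Bounding \<open>Max\<close> requires a nonempty set: each job is executed in one
    of the two ways.\<close>
  have "Exec j \<in> tasks S \<or> Untested j \<in> tasks S"
    using assms by (auto simp: feasible_def)
  then have "Exec j \<in> tasks ?R \<or> Untested j \<in> tasks ?R"
    using feasible_set_completion_order[OF assms(1)] by simp
  then have "?E ?R \<noteq> {}"
    unfolding tasks_def by force
  moreover have "end_of a \<le> Max (end_of ` ?E S)" if a: "a \<in> ?E ?R" for a
  proof -
    obtain b where "b \<in> set S" "task_of b = task_of a" "end_of a \<le> end_of b"
      using run_completion_order_end_le[OF assms(1)] a by blast
    then show ?thesis
      using a by (intro Max.coboundedI[THEN order_trans[rotated]]) auto
  qed
  ultimately show ?thesis
    unfolding completion_def by (intro Max.boundedI) auto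
qed


subsection \<open>The non-preemptive algorithm\<close>

lemma duration_nonneg:
  "valid_inst I \<Longrightarrow> job_of x < length I \<Longrightarrow> 0 \<le> duration I x"
  by (cases x) (auto simp: valid_inst_def)

text \<open>The run has the same set of tasks as \<open>S\<close>, so the choice of which jobs to
  test carries over. Each task gets a single full piece, and tests still precede executions in the
  completion order.\<close>

lemma feasible_run_completion_order:
  assumes "valid_inst I" "feasible I S"
  shows "feasible I (run_from I 0 (completion_order I S))"
proof -
  let ?xs = "completion_order I S"
  let ?R = "run_from I 0 ?xs"
  have dist: "distinct ?xs"
    using distinct_completion_order feasible_no_rerun assms(2) by blast
  have set: "set ?xs = tasks S"
    using feasible_set_completion_order assms(2) by blast
  have jobs: "job_of x < length I" if "x \<in> set ?xs" for x
    using that assms(2) unfolding set by (auto simp: feasible_def tasks_def)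
  then have nonneg: "0 \<le> duration I x" if "x \<in> set ?xs" for x
    using that duration_nonneg assms(1) by blast
  have "job_of (task_of a) < length I \<and> 0 \<le> start_of a \<and> start_of a \<le> end_of a"
    if "a \<in> set ?R" for a
  proof -
    have "task_of a \<in> tasks ?R"
      using that by (simp add: tasks_def del: tasks_run_from)
    then show ?thesis
      using jobs run_from_times[OF nonneg that] by simp
  qed
  moreover have "sorted_wrt (\<lambda>a b. end_of a \<le> start_of b) ?R"
    using sorted_run_from nonneg by blast
  moreover have "\<forall>j < length I.
        (Untested j \<in> tasks S \<and> Test j \<notin> tasks S \<and> Exec j \<notin> tasks S) \<or>
        (Untested j \<notin> tasks S \<and> Test j \<in> tasks S \<and> Exec j \<in> tasks S)"
    using assms(2) by (simp add: feasible_def)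
  moreover have "\<not> finished I (take i ?R) (task_of (?R ! i))" if "i < length ?xs" for i
    using that dist by (auto simp: take_run_from finished_run_from task_of_nth_run_from
        in_set_conv_nth nth_eq_iff_index_eq)
  moreover have "finished I (take i ?R) (Test j)"
    if "i < length ?xs" "task_of (?R ! i) = Exec j" for i j
    using that dist completion_order_tests_first[of I S i j] assms(2)
    by (auto simp: take_run_from finished_run_from task_of_nth_run_from
        feasible_no_rerun feasible_tests_first)
  ultimately show ?thesis
    unfolding feasible_def tasks_run_from set length_run_from
    using finished_run_from[OF dist] set by blast
qed

text \<open>Only the execution of a tested job has a duration that the public data leave
  open.\<close>

lemma duration_cong:
  assumes "public_data I = public_data I'" "job_of x < length I"
    and "\<And>j. x = Exec j \<Longrightarrow> proc_time (I ! j) = proc_time (I' ! j)"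
  shows "duration I x = duration I' x"
proof -
  have "length I = length I'"
    using assms(1) by (metis length_map public_data_def)
  then have "(test_time (I ! job_of x), upper_limit (I ! job_of x)) =
      (test_time (I' ! job_of x), upper_limit (I' ! job_of x))"
    using assms(1,2) by (metis (no_types, lifting) nth_map public_data_def)
  then show ?thesis
    using assms(3) by (cases x) auto
qed

text \<open>As long as \<open>A\<close> has completed at most \<open>k\<close> tasks, each test it
  has finished is among the first \<open>k\<close> entries, so \<open>A\<close> receives the same
  information on both instances and chooses the same next piece. Once more than \<open>k\<close>
  tasks are completed, the first \<open>Suc k\<close> entries are settled.\<close>

lemma completion_order_cong:
  assumes "online_algorithm A" "valid_inst I" "valid_inst I'" "public_data I = public_data I'"
    and known: "\<And>j. j < length I \<Longrightarrow> Test j \<in> set (take k (completion_order I (A I))) \<Longrightarrow>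
                  proc_time (I ! j) = proc_time (I' ! j)"
  shows "take (Suc k) (completion_order I (A I)) = take (Suc k) (completion_order I' (A I'))"
proof -
  let ?S = "A I" and ?S' = "A I'"
  let ?P = "\<lambda>m. completion_order I (take m ?S)" and ?P' = "\<lambda>m. completion_order I' (take m ?S')"
  have feas: "feasible I ?S"
    using assms(1,2) by (simp add: online_algorithm_def)
  have step: "take (Suc m) ?S = take (Suc m) ?S'"
    if "take m ?S = take m ?S'"
      "\<And>j. j < length I \<Longrightarrow> finished I (take m ?S) (Test j) \<Longrightarrow> proc_time (I ! j) = proc_time (I' ! j)"
    for m
    using assms(1-4) that unfolding online_algorithm_def by blast
  \<comment> \<open>The induction runs over the pieces of \<open>A\<close>, since many of them may
    pass without completing a task. The schedules themselves are claimed to agree only while at most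
    \<open>k\<close> tasks are recorded.\<close>
  have "take (Suc k) (?P m) = take (Suc k) (?P' m) \<and>
      (length (?P m) \<le> k \<longrightarrow> take m ?S = take m ?S' \<and> ?P m = ?P' m)" for m
  proof (induction m)
    case (Suc m)
    show ?case
    proof (cases "length (?P m) \<le> k")
      case True
      then have eq: "take m ?S = take m ?S'" "?P m = ?P' m"
        using Suc.IH by auto
      have proc: "proc_time (I ! j) = proc_time (I' ! j)"
        if "j < length I" "finished I (take m ?S) (Test j)" for j
      proof -
        have "Test j \<in> set (?P m)"
          using that(2) set_completion_order no_rerun_take feasible_no_rerun feas by blast
        moreover obtain ys where "completion_order I ?S = ?P m @ ys"
          using completion_order_take by blast
        ultimately show ?thesis
          using known[OF that(1)] True by simp
      qed
      have eq': "take (Suc m) ?S = take (Suc m) ?S'"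
        using step eq(1) proc by blast
      have "?P (Suc m) = ?P' (Suc m)"
      proof (cases "m < length ?S")
        case True
        let ?a = "?S ! m"
        have split: "take (Suc m) ?S = take m ?S @ [?a]"
          using True by (rule take_Suc_conv_app_nth)
        have job: "job_of (task_of ?a) < length I"
          using feas True by (simp add: feasible_def)
        \<comment> \<open>The same piece could finish its task on one instance only if the durations
          differed. For an execution, the test has been finished earlier, so the processing times
          already agree.\<close>
        have "duration I (task_of ?a) = duration I' (task_of ?a)"
        proof (rule duration_cong[OF assms(4) job])
          fix j assume j: "task_of ?a = Exec j"
          then have "finished I (take m ?S) (Test j)"
            using feas True by (simp add: feasible_def)
          then show "proc_time (I ! j) = proc_time (I' ! j)"
            using proc job j by simp
        qed
        then show ?thesis
          unfolding eq'[symmetric] split completion_order_snoc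
          by (simp add: finished_def eq(2)[folded eq(1)])
      next
        case False
        then have "take (Suc m) ?S = take m ?S"
          by simp
        then show ?thesis
          using eq eq' by metis
      qed
      with eq' show ?thesis by simp
    next
      case False
      obtain ys ys' where ext: "?P (Suc m) = ?P m @ ys" "?P' (Suc m) = ?P' m @ ys'"
        using completion_order_take[of I "take (Suc m) ?S" m]
          completion_order_take[of I' "take (Suc m) ?S'" m] by (auto simp: min_def)
      have IH: "take (Suc k) (?P m) = take (Suc k) (?P' m)"
        using Suc.IH by blast
      \<comment> \<open>Comparing lengths shows that the order for \<open>I'\<close> also has more
        than \<open>k\<close> entries, so \<open>ys\<close> and \<open>ys'\<close> lie beyond the
        first \<open>Suc k\<close>.\<close>
      then have "min (length (?P m)) (Suc k) = min (length (?P' m)) (Suc k)"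
        by (metis length_take)
      with False IH show ?thesis
        by (simp add: ext)
    qed
  qed simp
  \<comment> \<open>At the larger of the two lengths both prefixes are the whole schedules.\<close>
  from this[of "max (length ?S) (length ?S')"] show ?thesis
    by simp
qed

text \<open>The next piece is determined by the next task in the completion order and by the
  durations up to and including that task; both must follow from the tests in the first
  \<open>k\<close> pieces.\<close>

lemma online_nonpreempt:
  assumes "online_algorithm A"
  shows "online_algorithm (nonpreempt A)"
proof -
  have feas: "feasible I (A I)" if "valid_inst I" for I
    using assms that by (simp add: online_algorithm_def)
  have "take (Suc k) (nonpreempt A I) = take (Suc k) (nonpreempt A I')"
    if val: "valid_inst I" "valid_inst I'" and pub: "public_data I = public_data I'"
      and known: "\<forall>j < length I. finished I (take k (nonpreempt A I)) (Test j) \<longrightarrow>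
            proc_time (I ! j) = proc_time (I' ! j)" for I I' k
  proof -
    let ?xs = "completion_order I (A I)"
    note F = feas[OF val(1)]
    have "distinct ?xs"
      using distinct_completion_order feasible_no_rerun F by blast
    then have known': "proc_time (I ! j) = proc_time (I' ! j)"
      if "j < length I" "Test j \<in> set (take k ?xs)" for j
      using known that by (simp add: nonpreempt_def take_run_from finished_run_from)
    \<comment> \<open>Even the entry at position \<open>k\<close> is covered: if it is an execution,
      its test stands strictly earlier, hence among the first \<open>k\<close> entries.\<close>
    have "duration I x = duration I' x" if x: "x \<in> set (take (Suc k) ?xs)" for x
    proof -
      obtain i where i: "i \<le> k" "i < length ?xs" "x = ?xs ! i"
        using x by (auto simp: in_set_conv_nth less_Suc_eq_le)
      have "x \<in> tasks (A I)"
        using i feasible_set_completion_order[OF F] nth_mem by blast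
      then have job: "job_of x < length I"
        using F by (auto simp: feasible_def tasks_def)
      show ?thesis
      proof (rule duration_cong[OF pub job])
        fix j assume "x = Exec j"
        moreover from this have "Test j \<in> set (take i ?xs)"
          using completion_order_tests_first feasible_no_rerun feasible_tests_first F i by metis
        ultimately show "proc_time (I ! j) = proc_time (I' ! j)"
          using known' job set_take_subset_set_take[OF i(1)] by (metis subsetD task.sel(2))
      qed
    qed
    then have "run_from I 0 (take (Suc k) ?xs) = run_from I' 0 (take (Suc k) ?xs)"
      by (rule run_from_cong)
    then show ?thesis
      using completion_order_cong[OF assms val pub known']
      by (simp add: nonpreempt_def take_run_from)
  qed
  then show ?thesis
    using feasible_run_completion_order[OF _ feas]
    unfolding online_algorithm_def nonpreempt_def by blast
qed

theorem lemma10: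
  fixes A :: "inst \<Rightarrow> sched"
  assumes "online_algorithm A"
  shows "\<exists>B. online_algorithm B \<and>
             (\<forall>I. valid_inst I \<longrightarrow> nonpreemptive (B I)) \<and>
             competitive_ratio B \<le> competitive_ratio A"
proof (intro exI conjI allI impI)
  have feas: "feasible I (A I)" if "valid_inst I" for I
    using assms that by (simp add: online_algorithm_def)
  show "online_algorithm (nonpreempt A)"
    using assms by (rule online_nonpreempt)
  show "nonpreemptive (nonpreempt A I)" if "valid_inst I" for I
    using distinct_completion_order[OF feasible_no_rerun[OF feas[OF that]]]
    by (simp add: nonpreemptive_def nonpreempt_def)
  have "cost I (nonpreempt A I) \<le> cost I (A I)" if "valid_inst I" for I
    unfolding cost_def nonpreempt_def
    by (intro sum_mono completion_run_completion_order_le[OF feas[OF that]]) simp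
  \<comment> \<open>Each constant that bounds the ratio for \<open>A\<close> also bounds it for
    \<open>nonpreempt A\<close>, so the infimum is taken over a larger set.\<close>
  then show "competitive_ratio (nonpreempt A) \<le> competitive_ratio A"
    unfolding competitive_ratio_def by (intro Inf_superset_mono) (blast intro: order_trans)
qed

end
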